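(* Let $\lambda_1,\lambda_2,\lambda_3\in\mathbb{R}$ and let $p_1,p_2,p_3\in\mathbb{R}$ satisfy $\lambda_1\lambda_2p_1^2+\lambda_1\lambda_3p_2^2+\lambda_2\lambda_3p_3^2=1$. Put $$\mathcal{P}=\begin{bmatrix}0&-\lambda_1\lambda_2p_1&-\lambda_1\lambda_3p_2&-\lambda_2\lambda_3p_3\\ p_1&0&-\lambda_3p_3&\lambda_3p_2\\ p_2&\lambda_2p_3&0&-\lambda_2p_1\\ p_3&-\lambda_1p_2&\lambda_1p_1&0\end{bmatrix}.$$ Then for every $\alpha\in\mathbb{R}$, $$e^{\mathcal{P}\alpha}=(\cos\alpha) I_4+(\sin\alpha)\mathcal{P}=\begin{bmatrix}\cos\alpha&-\lambda_1\lambda_2p_1\sin\alpha&-\lambda_1\lambda_3p_2\sin\alpha&-\lambda_2\lambda_3p_3\sin\alpha\\ p_1\sin\alpha&\cos\alpha&-\lambda_3p_3\sin\alpha&\lambda_3p_2\sin\alpha\\ p_2\sin\alpha&\lambda_2p_3\sin\alpha&\cos\alpha&-\lambda_2p_1\sin\alpha\\ p_3\sin\alpha&-\lambda_1p_2\sin\alpha&\lambda_1p_1\sin\alpha&\cos\alpha\end{bmatrix}.$$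
   Context: $e^{\mathcal{P}\alpha}$ is the matrix exponential; $I_4$ is the $4\times4$ identity matrix. *)

theory Defs
  imports "HOL-Analysis.Analysis"
begin

(* The class instance of times for vectors multiplies componentwise, so the powers written with the
   operator ^ on the type real ^ 'n ^ 'n are not the powers of the matrix product **. *)
primrec matrix_power :: "real ^ 'n ^ 'n \<Rightarrow> nat \<Rightarrow> real ^ 'n ^ 'n" where
  "matrix_power A 0 = mat 1"
| "matrix_power A (Suc k) = A ** matrix_power A k"

definition matrix_exp :: "real ^ 'n ^ 'n \<Rightarrow> real ^ 'n ^ 'n" where
  "matrix_exp A = (\<Sum>k. (1 / fact k) *\<^sub>R matrix_power A k)"

lemma matrix_power_entry_bound:
  fixes A :: "real ^ 'n ^ 'n"
  shows "\<bar>matrix_power A k $ i $ j\<bar> \<le> (of_nat CARD('n) * norm A) ^ k"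
proof (induction k arbitrary: i j)
  case 0
  show ?case by (simp add: mat_def)
next
  case (Suc k)
  have entry: "\<bar>A $ i $ l\<bar> \<le> norm A" for l
    using component_le_norm_cart[of "A $ i" l] Finite_Cartesian_Product.norm_nth_le[of A i] by linarith
  have "\<bar>matrix_power A (Suc k) $ i $ j\<bar> \<le> (\<Sum>l\<in>UNIV. \<bar>A $ i $ l * matrix_power A k $ l $ j\<bar>)"
    by (simp add: matrix_matrix_mult_def sum_abs)
  also have "\<dots> \<le> (\<Sum>l\<in>(UNIV::'n set). norm A * (of_nat CARD('n) * norm A) ^ k)"
    unfolding abs_mult by (intro sum_mono mult_mono entry Suc.IH) auto
  also have "\<dots> = (of_nat CARD('n) * norm A) ^ Suc k"
    by simp
  finally show ?case .
qed

lemma summable_matrix_exp: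
  fixes A :: "real ^ 'n ^ 'n"
  shows "summable (\<lambda>k. (1 / fact k) *\<^sub>R matrix_power A k)"
proof -
  define c where "c = of_nat CARD('n) * norm A"
  have bound: "norm ((1 / fact k) *\<^sub>R matrix_power A k)
      \<le> (of_nat CARD('n) * of_nat CARD('n)) * (inverse (fact k) * c ^ k)" for k
  proof -
    have "norm (matrix_power A k) \<le> (\<Sum>i\<in>UNIV. norm (matrix_power A k $ i))"
      by (simp add: norm_vec_def L2_set_le_sum)
    also have "\<dots> \<le> (\<Sum>i\<in>UNIV. \<Sum>j\<in>UNIV. \<bar>matrix_power A k $ i $ j\<bar>)"
      by (intro sum_mono norm_le_l1_cart)
    also have "\<dots> \<le> (\<Sum>i\<in>(UNIV::'n set). \<Sum>j\<in>(UNIV::'n set). c ^ k)"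
      unfolding c_def by (intro sum_mono matrix_power_entry_bound)
    also have "\<dots> = (of_nat CARD('n) * of_nat CARD('n)) * c ^ k"
      by simp
    finally show ?thesis
      by (simp add: field_simps)
  qed
  have "summable (\<lambda>k. (of_nat CARD('n) * of_nat CARD('n)) * (inverse (fact k) * c ^ k))"
    by (intro summable_mult summable_exp)
  then show ?thesis
    by (rule summable_comparison_test') (rule bound)
qed

lemma vector_4:
  "(vector [x, y, z, w] :: 'a::zero ^ 4) $ 1 = x"
  "(vector [x, y, z, w] :: 'a::zero ^ 4) $ 2 = y"
  "(vector [x, y, z, w] :: 'a::zero ^ 4) $ 3 = z"
  "(vector [x, y, z, w] :: 'a::zero ^ 4) $ 4 = w"
  unfolding vector_def by simp_all

end

theory Submission
  imports Defs
begin

text \<open>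
  The normalisation of $p_1, p_2, p_3$ says exactly that $\mathcal{P}^2 = -I$, so $\mathcal{P}$ plays
  the role of an imaginary unit and the claim is Euler's formula: the powers of $\mathcal{P}$ run
  through $I, \mathcal{P}, -I, -\mathcal{P}$, the even terms of the exponential series add up to the
  cosine series times $I$ and the odd ones to the sine series times $\mathcal{P}$. This argument
  works for a real square matrix of any size with square $-I$, and is carried out in that generality;
  the shape of $\mathcal{P}$ enters only through the identity $\mathcal{P}^2 = -I$.
\<close>

text \<open>
  Powers are expressed through the Taylor coefficients of cosine and sine because their recursions
  (each coefficient at \<open>Suc k\<close> is, up to sign, the other one at \<open>k\<close> divided by \<open>Suc k\<close>) match
  multiplication by a matrix whose square is \<open>- mat 1\<close>. This avoids a case distinction on parity, and
  puts the terms of the exponential series directly into the form of those of cosine and sine.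
\<close>

lemma matrix_power_square_minus_one:
  fixes J :: "real ^ 'n ^ 'n"
  assumes "J ** J = - mat 1"
  shows "(1 / fact k) *\<^sub>R matrix_power (a *\<^sub>R J) k
    = (cos_coeff k * a ^ k) *\<^sub>R mat 1 + (sin_coeff k * a ^ k) *\<^sub>R J"
proof (induction k)
  case 0
  show ?case by simp
next
  case (Suc k)
  have "(1 / fact (Suc k)) *\<^sub>R matrix_power (a *\<^sub>R J) (Suc k)
      = (a / real (Suc k)) *\<^sub>R (J ** ((1 / fact k) *\<^sub>R matrix_power (a *\<^sub>R J) k))"
    by (simp add: matrix_scalar_ac field_simps
        flip: scalar_matrix_assoc)
  also have "\<dots> = (a / real (Suc k)) *\<^sub>R
      ((cos_coeff k * a ^ k) *\<^sub>R J - (sin_coeff k * a ^ k) *\<^sub>R mat 1)"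
    unfolding Suc.IH
    by (simp add: matrix_add_ldistrib matrix_scalar_ac assms flip: scalar_matrix_assoc)
  also have "\<dots> = (cos_coeff (Suc k) * a ^ Suc k) *\<^sub>R mat 1
      + (sin_coeff (Suc k) * a ^ Suc k) *\<^sub>R J"
    unfolding cos_coeff_Suc sin_coeff_Suc by (simp add: algebra_simps)
  finally show ?case .
qed

lemma matrix_exp_square_minus_one:
  fixes J :: "real ^ 'n ^ 'n"
  assumes "J ** J = - mat 1"
  shows "matrix_exp (a *\<^sub>R J) = cos a *\<^sub>R mat 1 + sin a *\<^sub>R J"
proof -
  have "(\<lambda>k. (cos_coeff k * a ^ k) *\<^sub>R mat 1 + (sin_coeff k * a ^ k) *\<^sub>R J)
      sums (cos a *\<^sub>R mat 1 + sin a *\<^sub>R J)"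
    using cos_converges[of a] sin_converges[of a]
    by (intro sums_add sums_scaleR_left) simp_all
  then show ?thesis
    unfolding matrix_exp_def matrix_power_square_minus_one[OF assms]
    by (rule sums_unique[symmetric])
qed

theorem mainTheorem4:
  fixes l\<^sub>1 l\<^sub>2 l\<^sub>3 p\<^sub>1 p\<^sub>2 p\<^sub>3 \<alpha> :: real
    and P :: "real ^ 4 ^ 4"
  assumes "l\<^sub>1 * l\<^sub>2 * p\<^sub>1\<^sup>2 + l\<^sub>1 * l\<^sub>3 * p\<^sub>2\<^sup>2 + l\<^sub>2 * l\<^sub>3 * p\<^sub>3\<^sup>2 = 1"
    and "P = vector
      [vector [0, - l\<^sub>1 * l\<^sub>2 * p\<^sub>1, - l\<^sub>1 * l\<^sub>3 * p\<^sub>2, - l\<^sub>2 * l\<^sub>3 * p\<^sub>3],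
       vector [p\<^sub>1, 0, - l\<^sub>3 * p\<^sub>3, l\<^sub>3 * p\<^sub>2],
       vector [p\<^sub>2, l\<^sub>2 * p\<^sub>3, 0, - l\<^sub>2 * p\<^sub>1],
       vector [p\<^sub>3, - l\<^sub>1 * p\<^sub>2, l\<^sub>1 * p\<^sub>1, 0]]"
  shows "matrix_exp (\<alpha> *\<^sub>R P) = cos \<alpha> *\<^sub>R mat 1 + sin \<alpha> *\<^sub>R P
    \<and> cos \<alpha> *\<^sub>R mat 1 + sin \<alpha> *\<^sub>R P = vector
      [vector [cos \<alpha>, - l\<^sub>1 * l\<^sub>2 * p\<^sub>1 * sin \<alpha>, - l\<^sub>1 * l\<^sub>3 * p\<^sub>2 * sin \<alpha>, - l\<^sub>2 * l\<^sub>3 * p\<^sub>3 * sin \<alpha>],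
       vector [p\<^sub>1 * sin \<alpha>, cos \<alpha>, - l\<^sub>3 * p\<^sub>3 * sin \<alpha>, l\<^sub>3 * p\<^sub>2 * sin \<alpha>],
       vector [p\<^sub>2 * sin \<alpha>, l\<^sub>2 * p\<^sub>3 * sin \<alpha>, cos \<alpha>, - l\<^sub>2 * p\<^sub>1 * sin \<alpha>],
       vector [p\<^sub>3 * sin \<alpha>, - l\<^sub>1 * p\<^sub>2 * sin \<alpha>, l\<^sub>1 * p\<^sub>1 * sin \<alpha>, cos \<alpha>]]"
proof
  have "P ** P = - mat 1"
    using assms(1) unfolding assms(2)
    by (simp add: vec_eq_iff forall_4 matrix_matrix_mult_def sum_4 vector_4 mat_def
        power2_eq_square algebra_simps)
  then show "matrix_exp (\<alpha> *\<^sub>R P) = cos \<alpha> *\<^sub>R mat 1 + sin \<alpha> *\<^sub>R P"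
    by (rule matrix_exp_square_minus_one)
qed (simp add: assms(2) vec_eq_iff forall_4 vector_4 mat_def)

end
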